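(* Let $p\ge3$ be an integer and let $\mu$ be a $p$-adic missing digits measure on $\mathbb{R}$ with digit set $\{a_1,\dots,a_r\}$, and let $\phi$ be its Lyapunov function. If $\int_0^1\phi(x)\,dx>1/2$, then $\mu$ is spectral. Let $k\ge1$ be the smallest integer such that $m_\mu(k)>1/2$. Then \[ \dim_{\mathrm{R}}\mu\ge\frac{1}{\log p}\cdot\frac{(m_\mu(k)-0.5)^2/2}{k\sigma_\mu^2(k)+3^{-1}kC_\mu(k)(m_\mu(k)-0.5)}. \]
   Context: Here $0=a_1<\dots<a_r\le p-1$ are integers with $1<r<p$, and $\mu$ is the law of $\sum_{j\ge1}b_jp^{-j}$ with $b_j$ i.i.d. uniform on $\{a_1,\dots,a_r\}$. The Lyapunov function is $\phi(x)=-\log\big|r^{-1}\sum_{i=1}^re^{-2\pi ia_ix}\big|/\log p$. For $k\ge1$, let $\phi_{p^k}(x)=\inf_{y\in I}\phi(y)$ where $I$ is the interval $[j/p^k,(j+1)/p^k)$, $j\in\mathbb{Z}$, containing $x$. Let $X$ be the random variable taking each of the $p^k$ values of $\phi_{p^k}$ on the intervals $[j/p^k,(j+1)/p^k)$, $j=0,\dots,p^k-1$, with probability $p^{-k}$; set $m_\mu(k)=E[X]$, $\sigma^2_\mu(k)=\mathrm{Var}[X]$, $C_\mu(k)=\max X$. With $\hat\mu(\xi)=\int e^{-2\pi ix\xi}d\mu(x)$, $\mu$ is spectral if there exist $\Delta>1/2$ and $\lambda>0$ with $\#\{\xi\in\mathbb{Z}\cap[0,N]:|\hat\mu(\xi)|\ge|\xi|^{-\Delta}\}\ll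 N^{1-\lambda}$, and the residue dimension $\dim_{\mathrm{R}}\mu$ is the supremum of such $\lambda$. *)

theory Defs
  imports "HOL-Probability.Probability" "HOL-Library.Landau_Symbols"
begin

text \<open>Law of the series of \<open>b\<^sub>j p\<^sup>-\<^sup>j\<close> over \<open>j \<ge> 1\<close>; the digit \<open>b\<^sub>j\<close> is coordinate \<open>j - 1\<close>.\<close>

definition missing_digits_measure :: "nat \<Rightarrow> nat set \<Rightarrow> real measure" where
  "missing_digits_measure p A =
     distr (Pi\<^sub>M (UNIV :: nat set) (\<lambda>_. measure_pmf (pmf_of_set A))) borel
       (\<lambda>b. \<Sum>j. real (b j) / real p ^ Suc j)"

definition digit_char :: "nat set \<Rightarrow> real \<Rightarrow> complex" where
  "digit_char A x = (\<Sum>a\<in>A. exp (- 2 * of_real pi * \<i> * of_nat a * of_real x)) / of_nat (card A)"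

text \<open>The value is \<open>\<infinity>\<close> at zeros of the exponential sum (\<open>ln 0 = 0\<close> in the library would
  give \<open>0\<close> there and spoil the infima below).\<close>

definition lyapunov :: "nat \<Rightarrow> nat set \<Rightarrow> real \<Rightarrow> ereal" where
  "lyapunov p A x =
     (if digit_char A x = 0 then \<infinity>
      else ereal (- ln (norm (digit_char A x)) / ln (real p)))"

definition lyapunov_step :: "nat \<Rightarrow> nat set \<Rightarrow> nat \<Rightarrow> real \<Rightarrow> ereal" where
  "lyapunov_step p A k x =
     (let j = \<lfloor>x * real p ^ k\<rfloor> in
      INF y\<in>{of_int j / real p ^ k ..< (of_int j + 1) / real p ^ k}. lyapunov p A y)"

text \<open>The random variable \<open>X\<close>, on the uniform space \<open>{..<p^k}\<close>. A nonzero trigonometric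
  polynomial does not vanish on an interval, so every infimum is finite and
  \<open>real_of_ereal\<close> loses nothing.\<close>

definition step_value :: "nat \<Rightarrow> nat set \<Rightarrow> nat \<Rightarrow> nat \<Rightarrow> real" where
  "step_value p A k j = real_of_ereal (lyapunov_step p A k (real j / real p ^ k))"

definition step_mean :: "nat \<Rightarrow> nat set \<Rightarrow> nat \<Rightarrow> real" where
  "step_mean p A k = measure_pmf.expectation (pmf_of_set {..<p ^ k}) (step_value p A k)"

definition step_var :: "nat \<Rightarrow> nat set \<Rightarrow> nat \<Rightarrow> real" where
  "step_var p A k = measure_pmf.variance (pmf_of_set {..<p ^ k}) (step_value p A k)"

definition step_max :: "nat \<Rightarrow> nat set \<Rightarrow> nat \<Rightarrow> real" where
  "step_max p A k = Max (step_value p A k ` {..<p ^ k})"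

definition fourier :: "real measure \<Rightarrow> real \<Rightarrow> complex" where
  "fourier M \<xi> = (CLINT x|M. exp (- 2 * of_real pi * \<i> * of_real x * of_real \<xi>))"

text \<open>\<open>0 powr (-\<Delta>) = 0\<close>, so \<open>\<xi> = 0\<close> is counted. Reading \<open>0\<close> to the power \<open>-\<Delta>\<close> as \<open>\<infinity>\<close> instead
  lowers the count by one, which is immaterial for \<open>\<lambda> \<le> 1\<close>; for missing digits measures no
  \<open>\<lambda> > 1\<close> is admissible under either reading.\<close>

definition residue_bound :: "real measure \<Rightarrow> real \<Rightarrow> real \<Rightarrow> bool" where
  "residue_bound M \<Delta> lam \<longleftrightarrow>
     (\<lambda>N::nat. real (card {\<xi> \<in> {0..int N}. norm (fourier M (of_int \<xi>)) \<ge> real_of_int \<bar>\<xi>\<bar> powr (- \<Delta>)}))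
       \<in> O(\<lambda>N. real N powr (1 - lam))"

definition spectral :: "real measure \<Rightarrow> bool" where
  "spectral M \<longleftrightarrow> (\<exists>\<Delta>>1/2. \<exists>lam>0. residue_bound M \<Delta> lam)"

definition residue_dim :: "real measure \<Rightarrow> ereal" where
  "residue_dim M = Sup (ereal ` {lam. lam > 0 \<and> (\<exists>\<Delta>>1/2. residue_bound M \<Delta> lam)})"

lemma prob_space_missing_digits_measure: "prob_space (missing_digits_measure p A)"
proof -
  interpret product_prob_space "\<lambda>_::nat. measure_pmf (pmf_of_set A)" UNIV
    by unfold_locales
  show ?thesis
    unfolding missing_digits_measure_def
    by (rule P.prob_space_distr) measurable
qed

lemma norm_digit_char_le_1: "norm (digit_char A x) \<le> 1"
proof -
  have "norm (\<Sum>a\<in>A. exp (- 2 * of_real pi * \<i> * of_nat a * of_real x)) \<le> (\<Sum>a\<in>A. 1)"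
    by (rule sum_norm_le) (simp add: norm_exp_eq_Re)
  then show ?thesis
    by (simp add: digit_char_def norm_divide divide_le_eq)
qed

lemma lyapunov_nonneg: "p \<ge> 1 \<Longrightarrow> lyapunov p A x \<ge> 0"
  using norm_digit_char_le_1[of A x] by (auto simp: lyapunov_def intro!: divide_nonpos_nonneg)

end

theory Submission
  imports Defs "HOL-Computational_Algebra.Polynomial"
begin

text \<open>
  Self-similarity gives \<open>\<mu>^(\<xi>) = \<Prod>\<^sub>j g(\<xi> / p\<^sup>j)\<close> with \<open>g\<close> the digit character, so
  \<open>|\<mu>^(\<xi>)|\<close> is at most \<open>p\<close> to the power minus the sum of the values \<open>X\<close> at the windows of
  \<open>k\<close> consecutive base-\<open>p\<close> digits of \<open>\<xi>\<close>. Windows whose positions are congruent modulo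
  \<open>k\<close> are disjoint, hence independent for uniformly distributed \<open>\<xi>\<close>. If \<open>|\<mu>^(\<xi>)|\<close> is large, then in one
  of the \<open>k\<close> residue classes the sample mean of \<open>X\<close> is below \<open>\<Delta> < E X\<close>, and Bernstein's inequality
  bounds the number of such \<open>\<xi>\<close>; letting \<open>\<Delta>\<close> decrease to \<open>1/2\<close> gives the estimate. That some \<open>k\<close>
  has \<open>E X > 1/2\<close> follows from Fatou's lemma, because \<open>\<phi>\<close> is lower semicontinuous and therefore
  at most the lower limit of its step functions.
\<close>

section \<open>Bernstein's inequality for the lower tail\<close>

text \<open>The denominator depends on \<open>y\<close> alone, so one quadratic serves every
  \<open>x \<le> y\<close>; it increases with \<open>y\<close>, which reduces the claim to
  \<open>y = 0\<close> for \<open>x \<le> 0\<close> (Taylor, with nonpositive cubic remainder) and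
  to \<open>y = x\<close> for \<open>x > 0\<close>.\<close>

lemma exp_le_quadratic:
  fixes x y :: real
  assumes "x \<le> y" "0 \<le> y" "y < 3"
  shows "exp x \<le> 1 + x + x\<^sup>2 / (2 * (1 - y / 3))"
proof (cases "x \<le> 0")
  case True
  obtain t where t: "exp x = (\<Sum>m<3. x ^ m / fact m) + exp t / fact 3 * x ^ 3"
    using Maclaurin_exp_le[of x 3] by blast
  have "exp t / fact 3 * x ^ 3 \<le> 0"
    using True by (intro mult_nonneg_nonpos) (auto simp: power3_eq_cube mult_nonneg_nonpos zero_le_mult_iff mult_le_0_iff)
  then have "exp x \<le> 1 + x + x\<^sup>2 / 2"
    using t by (simp add: eval_nat_numeral)
  also have "x\<^sup>2 / 2 \<le> x\<^sup>2 / (2 * (1 - y / 3))"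
    using assms by (intro divide_left_mono) auto
  finally show ?thesis by simp
next
  case False
  \<comment> \<open>\<open>f\<close> is the left side minus the right side after multiplication by
    \<open>1 - x / 3\<close>. Both \<open>f\<close> and its derivative \<open>f'\<close> vanish at
    0, and \<open>f'\<close> decreases because \<open>(1 - v) * exp v \<le> 1\<close>.\<close>
  define f where "f = (\<lambda>x::real. (1 - x / 3) * exp x - 1 - 2 * x / 3 - x\<^sup>2 / 6)"
  define f' where "f' = (\<lambda>x::real. (2 / 3 - x / 3) * exp x - 2 / 3 - x / 3)"
  have f'_le: "f' u \<le> 0" if "0 \<le> u" for u
  proof -
    have "f' u \<le> f' 0"
    proof (rule DERIV_nonpos_imp_nonincreasing[OF that])
      fix v :: real
      have "(1 - v) * exp v \<le> exp (- v) * exp v"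
        using exp_ge_add_one_self[of "- v"] by (intro mult_right_mono) auto
      then have "(1 / 3 - v / 3) * exp v - 1 / 3 \<le> 0"
        by (simp add: exp_minus field_simps)
      moreover have "(f' has_real_derivative (1 / 3 - v / 3) * exp v - 1 / 3) (at v)"
        unfolding f'_def by (auto intro!: derivative_eq_intros simp: field_simps)
      ultimately show "\<exists>z. (f' has_real_derivative z) (at v) \<and> z \<le> 0" by blast
    qed
    then show ?thesis by (simp add: f'_def)
  qed
  have "f x \<le> f 0"
  proof (rule DERIV_nonpos_imp_nonincreasing[of 0 x f])
    show "0 \<le> x" using False by simp
    fix v :: real assume "0 \<le> v" "v \<le> x"
    moreover have "(f has_real_derivative f' v) (at v)"
      unfolding f_def f'_def by (auto intro!: derivative_eq_intros simp: field_simps)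
    ultimately show "\<exists>z. (f has_real_derivative z) (at v) \<and> z \<le> 0" using f'_le by blast
  qed
  then have "(1 - x / 3) * exp x \<le> 1 + 2 * x / 3 + x\<^sup>2 / 6"
    by (simp add: f_def)
  also have "\<dots> = (1 - x / 3) * (1 + x + x\<^sup>2 / (2 * (1 - x / 3)))"
  proof -
    have "z * (x\<^sup>2 / (2 * z)) = x\<^sup>2 / 2" if "z \<noteq> 0" for z :: real
      using that by simp
    from this[of "1 - x / 3"] have "(1 - x / 3) * (x\<^sup>2 / (2 * (1 - x / 3))) = x\<^sup>2 / 2"
      using assms by simp
    then have "(1 - x / 3) * (1 + x + x\<^sup>2 / (2 * (1 - x / 3))) = (1 - x / 3) * (1 + x) + x\<^sup>2 / 2"
      by (simp only: distrib_left[of _ "1 + x"])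
    also have "\<dots> = 1 + 2 * x / 3 + x\<^sup>2 / 6"
      by (simp add: algebra_simps power2_eq_square add_divide_distrib)
    finally show ?thesis by (rule sym)
  qed
  finally have "exp x \<le> 1 + x + x\<^sup>2 / (2 * (1 - x / 3))"
    by (rule mult_left_le_imp_le) (use assms in simp)
  also have "x\<^sup>2 / (2 * (1 - x / 3)) \<le> x\<^sup>2 / (2 * (1 - y / 3))"
    using assms by (intro divide_left_mono mult_pos_pos) auto
  finally show ?thesis by simp
qed

text \<open>Apply the quadratic bound pointwise with \<open>y = s * C\<close>: the linear term has
  mean zero, the quadratic term gives the variance, and \<open>1 + z \<le> exp z\<close> finishes.
  Since that bound restricts its argument only from above, a one-sided bound on \<open>X\<close>
  suffices.\<close>

lemma bernstein_moment:
  fixes X :: "'a \<Rightarrow> real" and M :: "'a pmf"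
  assumes "finite (set_pmf M)"
    and lower: "\<And>v. v \<in> set_pmf M \<Longrightarrow> measure_pmf.expectation M X - X v \<le> C"
    and "0 \<le> C" "0 \<le> s" "s * C < 3"
  shows "measure_pmf.expectation M (\<lambda>v. exp (s * (measure_pmf.expectation M X - X v)))
     \<le> exp (measure_pmf.variance M X * s\<^sup>2 / (2 * (1 - s * C / 3)))"
proof -
  let ?m = "measure_pmf.expectation M X" and ?K = "2 * (1 - s * C / 3)"
  have int [simp]: "integrable M f" for f :: "'a \<Rightarrow> real"
    using assms(1) by (rule integrable_measure_pmf_finite)
  have "measure_pmf.expectation M (\<lambda>v. exp (s * (?m - X v))) \<le>
      measure_pmf.expectation M (\<lambda>v. 1 + s * (?m - X v) + (X v - ?m)\<^sup>2 * (s\<^sup>2 / ?K))"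
  proof (rule integral_mono_AE)
    show "AE v in measure_pmf M. exp (s * (?m - X v)) \<le> 1 + s * (?m - X v) + (X v - ?m)\<^sup>2 * (s\<^sup>2 / ?K)"
    proof (rule AE_pmfI)
      fix v assume "v \<in> set_pmf M"
      then have "s * (?m - X v) \<le> s * C" using lower assms by (intro mult_left_mono) auto
      from exp_le_quadratic[OF this] assms
      show "exp (s * (?m - X v)) \<le> 1 + s * (?m - X v) + (X v - ?m)\<^sup>2 * (s\<^sup>2 / ?K)"
        by (simp add: power_mult_distrib power2_commute mult.commute)
    qed
  qed simp_all
  also have "\<dots> = 1 + measure_pmf.variance M X * (s\<^sup>2 / ?K)"
    by (simp add: Bochner_Integration.integral_add Bochner_Integration.integral_diff algebra_simps del: integral_mult_left_zero)
  also have "\<dots> \<le> exp (measure_pmf.variance M X * (s\<^sup>2 / ?K))"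
    by (rule exp_ge_add_one_self)
  finally show ?thesis by simp
qed

text \<open>With \<open>s = t / (\<sigma>\<^sup>2 + C t / 3)\<close> the exponent \<open>- s t + \<sigma>\<^sup>2 s\<^sup>2 / (2 (1 - s C / 3))\<close> of the
  Chernoff bound equals \<open>- t\<^sup>2 / (2 (\<sigma>\<^sup>2 + C t / 3))\<close>.\<close>

lemma bernstein_chernoff:
  fixes X :: "'a \<Rightarrow> real" and M :: "'a pmf"
  assumes fin: "finite (set_pmf M)"
    and lower: "\<And>v. v \<in> set_pmf M \<Longrightarrow> measure_pmf.expectation M X - X v \<le> C"
    and C: "0 < C" and d: "d < measure_pmf.expectation M X"
    and t_def: "t = measure_pmf.expectation M X - d"
    and D_def: "D = measure_pmf.variance M X + C * t / 3"
  shows "measure_pmf.expectation M (\<lambda>v. exp (t / D * (d - X v))) \<le> exp (- (t\<^sup>2 / 2 / D))"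
proof -
  let ?m = "measure_pmf.expectation M X" and ?V = "measure_pmf.variance M X"
  define s where "s = t / D"
  have t: "t > 0" using d t_def by simp
  have V: "?V \<ge> 0" by simp
  have D: "D > 0" using V t C unfolding D_def by (intro add_nonneg_pos) auto
  have s: "s > 0" using t D by (simp add: s_def)
  \<comment> \<open>Through this identity the condition \<open>s * C < 3\<close> of the moment bound
    amounts to positive variance, hence the case split below.\<close>
  have sC: "1 - s * C / 3 = ?V / D"
  proof -
    have "s * C = 3 * (D - ?V) / D" by (simp add: s_def D_def algebra_simps)
    then show ?thesis using D by (simp add: field_simps)
  qed
  have "exp (s * (d - X v)) = exp (- s * t) * exp (s * (?m - X v))" for v
    unfolding exp_add[symmetric] t_def by (simp add: algebra_simps)
  then have eq: "measure_pmf.expectation M (\<lambda>v. exp (s * (d - X v)))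
     = exp (- s * t) * measure_pmf.expectation M (\<lambda>v. exp (s * (?m - X v)))"
    by (simp only: integral_mult_right_zero)
  show ?thesis
  proof (cases "?V = 0")
    case False
    then have "?V > 0" using V by linarith
    then have "?V / D > 0" using D by simp
    then have "s * C < 3" using sC by linarith
    then have "measure_pmf.expectation M (\<lambda>v. exp (s * (?m - X v))) \<le> exp (?V * s\<^sup>2 / (2 * (?V / D)))"
      using bernstein_moment[OF fin lower, of s] C s unfolding sC by simp
    also have "?V * s\<^sup>2 / (2 * (?V / D)) = s * t / 2"
      using False D by (simp add: s_def power2_eq_square)
    finally have "exp (- s * t) * measure_pmf.expectation M (\<lambda>v. exp (s * (?m - X v))) \<le> exp (- s * t) * exp (s * t / 2)"
      by (intro mult_left_mono) auto
    also have "\<dots> = exp (- (t\<^sup>2 / 2 / D))"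
      by (simp add: mult_exp_exp s_def power2_eq_square)
    finally show ?thesis by (simp only: eq s_def[symmetric])
  next
    case True
    then have "AE v in M. (X v - ?m)\<^sup>2 = 0"
      by (subst (asm) integral_nonneg_eq_0_iff_AE) (use fin in \<open>auto intro: integrable_measure_pmf_finite\<close>)
    then have "AE v in M. exp (s * (?m - X v)) = 1"
      by (rule eventually_mono) simp
    then have "measure_pmf.expectation M (\<lambda>v. exp (s * (?m - X v))) = measure_pmf.expectation M (\<lambda>v. 1)"
      by (intro integral_cong_AE) measurable
    then have "measure_pmf.expectation M (\<lambda>v. exp (s * (?m - X v))) = 1"
      by simp
    then have "measure_pmf.expectation M (\<lambda>v. exp (s * (d - X v))) = exp (- s * t)"
      by (simp only: eq mult_1_right)
    also have "\<dots> \<le> exp (- (t\<^sup>2 / 2 / D))"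
    proof -
      have "t\<^sup>2 / D \<ge> 0" using D by simp
      then show ?thesis by (simp add: s_def power2_eq_square)
    qed
    finally show ?thesis unfolding s_def .
  qed
qed

section \<open>The Fourier transform as a product\<close>

lemma summable_digits:
  fixes b :: "nat \<Rightarrow> nat"
  assumes "p \<ge> 2" "\<And>i. b i \<le> p"
  shows "summable (\<lambda>j. real (b j) / real p ^ Suc j)"
proof (rule summable_comparison_test')
  show "summable (\<lambda>j. (1 / real p) ^ j)"
    using assms(1) by (intro summable_geometric) auto
  fix j
  have "real (b j) / real p ^ Suc j \<le> real p / real p ^ Suc j"
    using assms by (intro divide_right_mono) auto
  then show "norm (real (b j) / real p ^ Suc j) \<le> (1 / real p) ^ j"
    using assms(1) by (simp add: power_one_over divide_simps)
qed

text \<open>Split off the first digit: it is independent of the remaining sequence, which again has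
  the law of the whole sequence, and the series equals (first digit + series of the rest) /
  \<open>p\<close>.\<close>

lemma fourier_missing_digits_rec:
  assumes p: "p \<ge> 2" and A: "finite A" "A \<noteq> {}" "\<And>a. a \<in> A \<Longrightarrow> a \<le> p"
  shows "fourier (missing_digits_measure p A) \<xi> =
    digit_char A (\<xi> / real p) * fourier (missing_digits_measure p A) (\<xi> / real p)"
proof -
  let ?M = "measure_pmf (pmf_of_set A)"
  let ?e = "\<lambda>x \<xi>. exp (- 2 * of_real pi * \<i> * of_real x * of_real \<xi>) :: complex"
  interpret sequence_space ?M by unfold_locales
  interpret Q: pair_prob_space ?M S by unfold_locales
  define F where "F = (\<lambda>b::nat \<Rightarrow> nat. \<Sum>j. real (b j) / real p ^ Suc j)"
  have [measurable]: "F \<in> borel_measurable S" unfolding F_def by measurable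
  have four: "fourier (missing_digits_measure p A) \<eta> = (CLINT b|S. ?e (F b) \<eta>)" for \<eta>
    unfolding fourier_def missing_digits_measure_def F_def[symmetric]
    by (rule integral_distr) measurable
  \<comment> \<open>The sample space contains all sequences of naturals, for which the series may
    diverge. Splitting the series is justified only for digits in \<open>A\<close>, that is almost
    surely.\<close>
  have AE_digits: "AE b in S. \<forall>i. b i \<in> A"
    unfolding AE_all_countable
    by (intro allI AE_PiM_component) (use A in \<open>auto intro: AE_pmfI prob_space_measure_pmf simp: AE_measure_pmf_iff\<close>)
  have F_cons: "F (case_nat s b) = real s / real p + F b / real p"
    if "s \<in> A" "\<forall>i. b i \<in> A" for s b
  proof -
    have "summable (\<lambda>j. real (case_nat s b j) / real p ^ Suc j)"
      using that A by (intro summable_digits p) (auto split: nat.split)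
    then have "F (case_nat s b) = real s / real p + (\<Sum>j. real (b j) / real p ^ Suc (Suc j))"
      unfolding F_def using suminf_split_head by fastforce
    also have "(\<Sum>j. real (b j) / real p ^ Suc (Suc j)) = (\<Sum>j. real (b j) / real p ^ Suc j / real p)"
      by (simp add: field_simps)
    also have "\<dots> = F b / real p"
      unfolding F_def using that A by (intro suminf_divide summable_digits p) auto
    finally show ?thesis .
  qed
  have "fourier (missing_digits_measure p A) \<xi> =
      (CLINT b|distr (?M \<Otimes>\<^sub>M S) S (\<lambda>(s, \<omega>). case_nat s \<omega>). ?e (F b) \<xi>)"
    unfolding PiM_iter four ..
  also have "\<dots> = (CLINT x|?M \<Otimes>\<^sub>M S. ?e (F (case x of (s, \<omega>) \<Rightarrow> case_nat s \<omega>)) \<xi>)"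
    by (rule integral_distr) measurable
  also have "\<dots> = (CLINT s|?M. CLINT \<omega>|S. ?e (F (case_nat s \<omega>)) \<xi>)"
    by (subst Q.integral_fst'[symmetric])
      (auto intro!: Q.P.integrable_const_bound[of _ 1] simp: case_prod_beta)
  also have "\<dots> = (CLINT s|?M. ?e (real s) (\<xi> / real p) * fourier (missing_digits_measure p A) (\<xi> / real p))"
  proof (intro integral_cong_AE AE_pmfI)
    fix s assume "s \<in> set_pmf (pmf_of_set A)"
    then have s: "s \<in> A" using A by simp
    have "(CLINT \<omega>|S. ?e (F (case_nat s \<omega>)) \<xi>) = (CLINT \<omega>|S. ?e (real s) (\<xi> / real p) * ?e (F \<omega>) (\<xi> / real p))"
    proof (rule integral_cong_AE)
      show "AE \<omega> in S. ?e (F (case_nat s \<omega>)) \<xi> = ?e (real s) (\<xi> / real p) * ?e (F \<omega>) (\<xi> / real p)"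
        using AE_digits by eventually_elim (simp add: F_cons s exp_add[symmetric] field_simps)
    qed measurable
    then show "(CLINT \<omega>|S. ?e (F (case_nat s \<omega>)) \<xi>) = ?e (real s) (\<xi> / real p) * fourier (missing_digits_measure p A) (\<xi> / real p)"
      by (simp add: four)
  qed measurable
  also have "\<dots> = (CLINT s|?M. ?e (real s) (\<xi> / real p)) * fourier (missing_digits_measure p A) (\<xi> / real p)"
    by simp
  also have "(CLINT s|?M. ?e (real s) (\<xi> / real p)) = digit_char A (\<xi> / real p)"
    using A by (subst integral_measure_pmf[of A])
      (auto simp: digit_char_def scaleR_conv_of_real sum_divide_distrib)
  finally show ?thesis .
qed

lemma norm_fourier_le_1:
  assumes "prob_space M" "sets M = sets borel"
  shows "norm (fourier M \<xi>) \<le> 1"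
proof -
  interpret prob_space M by fact
  have "norm (fourier M \<xi>) \<le> (LINT x|M. norm (exp (- 2 * of_real pi * \<i> * of_real x * of_real \<xi>) :: complex))"
    unfolding fourier_def by (rule integral_norm_bound)
  also have "\<dots> = 1" by (simp add: prob_space)
  finally show ?thesis .
qed

text \<open>Iterate the recursion \<open>n\<close> times; the leftover factor, the transform at
  \<open>\<xi> / real p ^ n\<close>, has norm at most 1.\<close>

lemma norm_fourier_missing_digits_le:
  assumes "p \<ge> 2" "finite A" "A \<noteq> {}" "\<And>a. a \<in> A \<Longrightarrow> a \<le> p"
  shows "norm (fourier (missing_digits_measure p A) \<xi>) \<le> (\<Prod>j=1..n. norm (digit_char A (\<xi> / real p ^ j)))"
proof -
  have "fourier (missing_digits_measure p A) \<xi> =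
     (\<Prod>j=1..n. digit_char A (\<xi> / real p ^ j)) * fourier (missing_digits_measure p A) (\<xi> / real p ^ n)"
  proof (induction n)
    case (Suc n)
    then show ?case
      using fourier_missing_digits_rec[OF assms, of "\<xi> / real p ^ n"] by (simp add: mult.commute)
  qed simp
  then show ?thesis
    using norm_fourier_le_1[OF prob_space_missing_digits_measure, of p A "\<xi> / real p ^ n"]
    by (simp add: norm_mult prod_norm missing_digits_measure_def mult_left_le prod_nonneg)
qed

section \<open>The Lyapunov function\<close>

lemma digit_char_add_int: "digit_char A (x + of_int n) = digit_char A x"
proof -
  have "exp (- 2 * of_real pi * \<i> * of_nat a * of_real (x + of_int n)) =
      (exp (- 2 * of_real pi * \<i> * of_nat a * of_real x) :: complex)" for a
    by (rule exp_eq[THEN iffD2], rule exI[of _ "- int a * n"]) (simp add: algebra_simps)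
  then show ?thesis by (simp add: digit_char_def)
qed

lemma continuous_on_digit_char: "continuous_on S (digit_char A)"
  unfolding digit_char_def by (cases "card A = 0") (auto intro!: continuous_intros)

text \<open>Up to the factor \<open>card A\<close>, the digit character is the nonzero polynomial
  \<open>P\<close> evaluated along the unit circle. The parametrisation \<open>e\<close> is
  injective on a half-open interval of length at most 1, so vanishing there would give
  \<open>P\<close> infinitely many roots.\<close>

lemma digit_char_nonzero_on_interval:
  assumes A: "finite A" "A \<noteq> {}" and ab: "a < b" "b \<le> a + 1"
  shows "\<exists>x\<in>{a..<b}. digit_char A x \<noteq> 0"
proof (rule ccontr)
  assume "\<not> ?thesis"
  then have zero: "digit_char A x = 0" if "x \<in> {a..<b}" for x using that by blast
  define e where "e = (\<lambda>x::real. exp (- 2 * of_real pi * \<i> * of_real x) :: complex)"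
  define P where "P = (\<Sum>n\<in>A. monom 1 n :: complex poly)"
  have coeff: "coeff P n = (if n \<in> A then 1 else 0)" for n
    using A by (simp add: P_def coeff_sum)
  then have "P \<noteq> 0" using A by (metis all_not_in_conv coeff_0 zero_neq_one)
  then have fin: "finite {z. poly P z = 0}" by (rule poly_roots_finite)
  have "e x ^ n = exp (- 2 * of_real pi * \<i> * of_nat n * of_real x)" for x n
    by (simp add: e_def exp_of_nat_mult[symmetric] algebra_simps)
  then have "poly P (e x) = of_nat (card A) * digit_char A x" for x
    using A by (simp add: P_def poly_sum poly_monom digit_char_def)
  then have "e ` {a..<b} \<subseteq> {z. poly P z = 0}" using zero by auto
  moreover have "inj_on e {a..<b}"
  proof (rule inj_onI)
    fix x y assume xy: "x \<in> {a..<b}" "y \<in> {a..<b}" and "e x = e y"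
    then obtain n :: int where
      "- 2 * of_real pi * \<i> * of_real x = - 2 * of_real pi * \<i> * of_real y + of_real (of_int (2 * n) * pi) * \<i>"
      unfolding e_def exp_eq by blast
    then have "Im (- 2 * of_real pi * \<i> * of_real x) = Im (- 2 * of_real pi * \<i> * of_real y + of_real (of_int (2 * n) * pi) * \<i>)"
      by simp
    then have "pi * (y - x) = pi * of_int n" by (simp add: algebra_simps)
    then have n: "y - x = of_int n" by simp
    moreover have "\<bar>y - x\<bar> < 1" using xy ab by auto
    ultimately have "n = 0" by linarith
    then show "x = y" using n by simp
  qed
  ultimately have "finite {a..<b}" using fin finite_imageD finite_subset by blast
  then show False using ab by (simp add: infinite_Ico)
qed

text \<open>Removing the logarithm also covers the zeros of the character, where both sides hold;
  strict superlevel sets of \<phi> are thereby expressed through a continuous function.\<close>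

lemma lyapunov_less_iff:
  assumes "p \<ge> 2"
  shows "ereal c < lyapunov p A x \<longleftrightarrow> norm (digit_char A x) < real p powr (- c)"
proof (cases "digit_char A x = 0")
  case False
  have "ereal c < lyapunov p A x \<longleftrightarrow> c < - ln (norm (digit_char A x)) / ln (real p)"
    using False by (simp add: lyapunov_def)
  also have "\<dots> \<longleftrightarrow> c * ln (real p) < - ln (norm (digit_char A x))"
    by (rule pos_less_divide_eq) (use assms in simp)
  also have "\<dots> \<longleftrightarrow> ln (norm (digit_char A x)) < - c * ln (real p)"
    by linarith
  also have "\<dots> \<longleftrightarrow> norm (digit_char A x) < exp (- c * ln (real p))"
    using False by (metis exp_less_cancel_iff exp_ln zero_less_norm_iff)
  finally show ?thesis using assms by (simp add: powr_def)
qed (use assms in \<open>auto simp: lyapunov_def\<close>)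

text \<open>This is the lower semicontinuity of \<phi>.\<close>

lemma open_lyapunov_greater:
  assumes "p \<ge> 2"
  shows "open {x. ereal c < lyapunov p A x}"
  unfolding lyapunov_less_iff[OF assms]
  by (intro open_Collect_less continuous_intros continuous_on_digit_char)

lemma lyapunov_step_nonneg: "p \<ge> 1 \<Longrightarrow> lyapunov_step p A k x \<ge> 0"
  by (auto simp: lyapunov_step_def Let_def intro!: INF_greatest lyapunov_nonneg)

lemma lyapunov_step_eq:
  assumes "p > 0" "\<lfloor>x * real p ^ k\<rfloor> = int j"
  shows "lyapunov_step p A k x = lyapunov_step p A k (real j / real p ^ k)"
  using assms by (simp add: lyapunov_step_def Let_def)

lemma step_value_nonneg: "p \<ge> 1 \<Longrightarrow> step_value p A k j \<ge> 0"
  unfolding step_value_def by (intro real_of_ereal_pos lyapunov_step_nonneg)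

lemma ereal_step_value:
  assumes "p \<ge> 2" "finite A" "A \<noteq> {}"
  shows "ereal (step_value p A k j) = lyapunov_step p A k (real j / real p ^ k)"
proof -
  let ?I = "{of_int (int j) / real p ^ k ..< (of_int (int j) + 1) / real p ^ k}"
  have p: "real p ^ k \<ge> 1" using assms by simp
  have "\<exists>y\<in>?I. digit_char A y \<noteq> 0"
    using assms p by (intro digit_char_nonzero_on_interval)
      (auto simp: field_simps divide_less_cancel)
  then obtain y where y: "y \<in> ?I" "digit_char A y \<noteq> 0" by blast
  have "lyapunov_step p A k (real j / real p ^ k) \<le> lyapunov p A y"
  proof -
    have "\<lfloor>real j / real p ^ k * real p ^ k\<rfloor> = int j" using assms by simp
    then show ?thesis unfolding lyapunov_step_def Let_def using y by (intro INF_lower) simp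
  qed
  also have "\<dots> < \<infinity>" using y by (simp add: lyapunov_def)
  finally show ?thesis
    using lyapunov_step_nonneg[of p A k "real j / real p ^ k"] assms
    by (auto simp: step_value_def ereal_real)
qed

text \<open>The character has period 1, so only the cell index modulo \<open>p ^ k\<close> matters,
  and the infimum over that cell is at most the value of \<phi> at the translated point.\<close>

lemma norm_digit_char_le_step_value:
  assumes p: "p \<ge> 2"
  shows "norm (digit_char A x) \<le> real p powr (- step_value p A k (nat (\<lfloor>x * real p ^ k\<rfloor> mod int p ^ k)))"
proof (cases "digit_char A x = 0")
  case False
  define u where "u = \<lfloor>x * real p ^ k\<rfloor>"
  define v where "v = nat (u mod int p ^ k)"
  \<comment> \<open>The integer translate of \<open>x\<close> that lies in cell \<open>v\<close> of
    the unit interval.\<close>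
  define y where "y = x + of_int (- (u div int p ^ k))"
  have pk: "int p ^ k > 0" "real p ^ k > 0" using p by auto
  have v: "int v = u - int p ^ k * (u div int p ^ k)"
    using pk by (simp add: v_def minus_mult_div_eq_mod)
  have vr: "real v = of_int u - real p ^ k * of_int (u div int p ^ k)"
    using arg_cong[OF v, of real_of_int] by simp
  have "of_int u \<le> x * real p ^ k" "x * real p ^ k < of_int u + 1"
    unfolding u_def by linarith+
  then have y: "y \<in> {of_int (int v) / real p ^ k ..< (of_int (int v) + 1) / real p ^ k}"
    using pk by (simp add: y_def vr field_simps)
  have nz: "digit_char A y = digit_char A x" unfolding y_def by (rule digit_char_add_int)
  have "lyapunov_step p A k (real v / real p ^ k) \<le> lyapunov p A y"
  proof -
    have "\<lfloor>real v / real p ^ k * real p ^ k\<rfloor> = int v" using pk by simp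
    then show ?thesis unfolding lyapunov_step_def Let_def using y by (intro INF_lower) simp
  qed
  also have "\<dots> = ereal (- ln (norm (digit_char A x)) / ln (real p))"
    using False by (simp add: lyapunov_def nz)
  finally have "step_value p A k v \<le> - ln (norm (digit_char A x)) / ln (real p)"
    unfolding step_value_def
    using lyapunov_step_nonneg[of p A k "real v / real p ^ k"] p
    by (cases "lyapunov_step p A k (real v / real p ^ k)") auto
  then have "ln (norm (digit_char A x)) \<le> - step_value p A k v * ln (real p)"
    using p by (simp add: field_simps)
  then have "norm (digit_char A x) \<le> exp (- step_value p A k v * ln (real p))"
    using False by (metis exp_le_cancel_iff exp_ln zero_less_norm_iff)
  then show ?thesis using p by (simp add: powr_def v_def u_def)
qed simp

section \<open>Sums over digit expansions\<close>

lemma sum_lessThan_mult: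
  fixes f :: "nat \<Rightarrow> 'a::comm_monoid_add"
  assumes "b > 0"
  shows "(\<Sum>x<a * b. f x) = (\<Sum>u<a. \<Sum>v<b. f (u * b + v))"
proof -
  have "(\<Sum>x<a * b. f x) = (\<Sum>u<a. sum f {u * b..<Suc u * b})"
  proof (induction a)
    case (Suc a)
    have "(\<Sum>x<Suc a * b. f x) = (\<Sum>x<a * b. f x) + sum f {a * b..<Suc a * b}"
      unfolding lessThan_atLeast0 by (subst sum.atLeastLessThan_concat) auto
    then show ?case by (simp add: Suc)
  qed simp
  moreover have "sum f {u * b..<Suc u * b} = (\<Sum>v<b. f (u * b + v))" for u
    using sum.shift_bounds_nat_ivl[of f 0 "u * b" b]
    by (simp add: atLeast0LessThan add.commute)
  ultimately show ?thesis by simp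
qed

text \<open>This is the independence of the base-\<open>b\<close> digits of a uniform
  \<open>x < b ^ q\<close>, by induction on splitting off the last digit.\<close>

lemma sum_prod_digits:
  fixes f :: "nat \<Rightarrow> 'a::comm_semiring_1"
  assumes "b > 0"
  shows "(\<Sum>x<b ^ q. \<Prod>i<q. f (x div b ^ i mod b)) = (\<Sum>v<b. f v) ^ q"
proof (induction q)
  case (Suc q)
  have "(\<Prod>i<Suc q. f ((u * b + v) div b ^ i mod b)) = f v * (\<Prod>i<q. f (u div b ^ i mod b))"
    if "v < b" for u v
  proof -
    have "(u * b + v) div b ^ Suc i = u div b ^ i" for i
      using that by (simp add: div_mult2_eq)
    then show ?thesis using that by (subst prod.lessThan_Suc_shift) simp
  qed
  then have "(\<Sum>x<b ^ Suc q. \<Prod>i<Suc q. f (x div b ^ i mod b))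
      = (\<Sum>u<b ^ q. \<Sum>v<b. f v * (\<Prod>i<q. f (u div b ^ i mod b)))"
    using sum_lessThan_mult[OF assms, of "\<lambda>x. \<Prod>i<Suc q. f (x div b ^ i mod b)" "b ^ q"]
    by (simp add: mult.commute)
  also have "\<dots> = (\<Sum>v<b. f v) ^ Suc q"
    by (simp add: sum_distrib_right[symmetric] sum_distrib_left[symmetric] Suc)
  finally show ?case .
qed simp

text \<open>The windows at \<open>c\<close>, \<open>c + k\<close>, ... are the
  base-\<open>p ^ k\<close> digits of \<open>x div p ^ c\<close>. The lowest \<open>c\<close> and
  the highest \<open>k - c\<close> of the \<open>k * Suc q\<close> digits lie in no window and
  together contribute the factor \<open>p ^ k\<close>.\<close>

lemma sum_prod_digits_shifted:
  fixes f :: "nat \<Rightarrow> 'a::comm_semiring_1"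
  assumes p: "p > 0" and c: "c \<le> k"
  shows "(\<Sum>x<p ^ (k * Suc q). \<Prod>i<q. f (x div p ^ (c + k * i) mod p ^ k))
    = of_nat (p ^ k) * (\<Sum>v<p ^ k. f v) ^ q"
proof -
  define g where "g = (\<lambda>y. \<Prod>i<q. f (y div (p ^ k) ^ i mod p ^ k))"
  have p': "p ^ n > 0" for n using p by simp
  have "x div p ^ (c + k * i) = x div p ^ c div (p ^ k) ^ i" for x i
    by (simp add: power_add power_mult div_mult2_eq)
  then have "(\<Sum>x<p ^ (k * Suc q). \<Prod>i<q. f (x div p ^ (c + k * i) mod p ^ k))
      = (\<Sum>x<p ^ (k * Suc q). g (x div p ^ c))"
    by (simp add: g_def)
  also have "(\<Sum>x<p ^ (k * Suc q). g (x div p ^ c)) = (\<Sum>x<p ^ (k - c) * (p ^ k) ^ q * p ^ c. g (x div p ^ c))"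
  proof -
    have "p ^ (k * Suc q) = p ^ (k - c) * (p ^ k) ^ q * p ^ c"
      using c by (simp add: power_mult[symmetric] power_add[symmetric])
    then show ?thesis by (simp only:)
  qed
  also have "(\<Sum>x<p ^ (k - c) * (p ^ k) ^ q * p ^ c. g (x div p ^ c))
     = of_nat (p ^ c) * (\<Sum>y<p ^ (k - c) * (p ^ k) ^ q. g y)"
    by (subst sum_lessThan_mult[OF p']) (use p in \<open>simp add: sum_distrib_left\<close>)
  also have "(\<Sum>y<p ^ (k - c) * (p ^ k) ^ q. g y) = (\<Sum>w<p ^ (k - c). \<Sum>z<(p ^ k) ^ q. g z)"
  proof -
    \<comment> \<open>A multiple of \<open>(p ^ k) ^ q\<close> does not change the lowest
      \<open>q\<close> digits in base \<open>p ^ k\<close>, the only ones that \<open>g\<close>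
      reads.\<close>
    have "g (w * (p ^ k) ^ q + z) = g z" for w z
      unfolding g_def
    proof (intro prod.cong refl arg_cong[of _ _ f])
      fix i assume "i \<in> {..<q}"
      then obtain d where "q = i + Suc d" using less_imp_Suc_add by auto
      then have "w * (p ^ k) ^ q + z = z + (p ^ k) ^ i * (p ^ k * (w * (p ^ k) ^ d))"
        by (simp add: power_add ac_simps)
      then have "(w * (p ^ k) ^ q + z) div (p ^ k) ^ i = z div (p ^ k) ^ i + p ^ k * (w * (p ^ k) ^ d)"
        using p by (metis add.commute div_mult_self2 not_gr0 power_not_zero)
      then show "(w * (p ^ k) ^ q + z) div (p ^ k) ^ i mod p ^ k = z div (p ^ k) ^ i mod p ^ k"
        by simp
    qed
    then show ?thesis by (subst sum_lessThan_mult) (use p in simp_all)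
  qed
  also have "(\<Sum>z<(p ^ k) ^ q. g z) = (\<Sum>v<p ^ k. f v) ^ q"
    unfolding g_def by (rule sum_prod_digits[OF p'])
  also have "of_nat (p ^ c) * (\<Sum>w<p ^ (k - c). (\<Sum>v<p ^ k. f v) ^ q) = of_nat (p ^ k) * (\<Sum>v<p ^ k. f v) ^ q"
    using c by (simp add: mult.assoc[symmetric] power_add[symmetric])
  finally show ?thesis .
qed

section \<open>Counting large Fourier coefficients\<close>

text \<open>The first \<open>k\<close> digits after the point of \<open>x / p ^ (m + k)\<close> are
  the digits of \<open>x\<close> at positions \<open>m\<close> to \<open>m + k - 1\<close>, so
  factor \<open>m + k\<close> of the product is bounded through one window.\<close>

lemma norm_fourier_le_step_values:
  assumes "p \<ge> 2" "finite A" "A \<noteq> {}" "\<And>a. a \<in> A \<Longrightarrow> a \<le> p"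
  shows "norm (fourier (missing_digits_measure p A) (real x))
    \<le> real p powr (- (\<Sum>c<k. \<Sum>i<q. step_value p A k (x div p ^ (c + k * i) mod p ^ k)))"
proof -
  define h where "h = (\<lambda>j. norm (digit_char A (real x / real p ^ j)))"
  define X where "X = (\<lambda>m. step_value p A k (x div p ^ m mod p ^ k))"
  have h: "0 \<le> h j" "h j \<le> 1" for j by (auto simp: h_def norm_digit_char_le_1)
  have hX: "h (m + k) \<le> real p powr (- X m)" for m
  proof -
    have "real x / real p ^ (m + k) * real p ^ k = real x / real (p ^ m)"
      using assms(1) by (simp add: power_add)
    then have "\<lfloor>real x / real p ^ (m + k) * real p ^ k\<rfloor> = int (x div p ^ m)"
      by (simp only: floor_divide_of_nat_eq)
    moreover have "nat (int (x div p ^ m) mod int p ^ k) = x div p ^ m mod p ^ k"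
      by (metis nat_int of_nat_mod of_nat_power)
    ultimately show ?thesis
      using norm_digit_char_le_step_value[OF assms(1), of A "real x / real p ^ (m + k)" k]
      by (simp only: h_def X_def)
  qed
  have "norm (fourier (missing_digits_measure p A) (real x)) \<le> (\<Prod>m<q * k. real p powr (- X m))"
  proof (cases k)
    case 0
    then show ?thesis
      using norm_fourier_missing_digits_le[OF assms, of "real x" 0] by simp
  next
    case (Suc n)
    \<comment> \<open>The remaining indices, those below \<open>k\<close> and
      \<open>q * k + k\<close> itself, carry factors at most 1 and are dropped.\<close>
    have sub: "(\<lambda>m. m + k) ` {..<q * k} \<subseteq> {1..q * k + k}" using Suc by auto
    have "norm (fourier (missing_digits_measure p A) (real x)) \<le> prod h {1..q * k + k}"
      unfolding h_def by (rule norm_fourier_missing_digits_le[OF assms])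
    also have "\<dots> = prod h ({1..q * k + k} - (\<lambda>m. m + k) ` {..<q * k}) * prod h ((\<lambda>m. m + k) ` {..<q * k})"
      using sub by (intro prod.subset_diff) auto
    also have "\<dots> \<le> prod h ((\<lambda>m. m + k) ` {..<q * k})"
      using h by (intro mult_left_le_one_le prod_nonneg prod_le_1) auto
    also have "\<dots> = (\<Prod>m<q * k. h (m + k))"
      by (subst prod.reindex) (auto simp: inj_on_def)
    also have "\<dots> \<le> (\<Prod>m<q * k. real p powr (- X m))"
      using h hX Suc by (intro prod_mono) auto
    finally show ?thesis .
  qed
  also have "\<dots> = real p powr (\<Sum>m<q * k. - X m)"
    using assms(1) by (subst powr_sum) auto
  \<comment> \<open>Sort the positions \<open>m = c + k * i\<close> by their residue
    \<open>c\<close> modulo \<open>k\<close>.\<close>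
  also have "(\<Sum>m<q * k. - X m) = - (\<Sum>c<k. \<Sum>i<q. X (c + k * i))"
  proof (cases "k = 0")
    case False
    then have "(\<Sum>m<q * k. X m) = (\<Sum>i<q. \<Sum>c<k. X (i * k + c))"
      by (intro sum_lessThan_mult) simp
    also have "\<dots> = (\<Sum>c<k. \<Sum>i<q. X (c + k * i))"
      by (subst sum.swap) (simp add: ac_simps)
    finally show ?thesis by (simp add: sum_negf)
  qed simp
  finally show ?thesis by (simp add: X_def)
qed

text \<open>Pigeonhole over the \<open>k\<close> residue classes, then a Chernoff bound in each. The
  factor \<open>k\<close> is the union bound, the separate \<open>p ^ k\<close> comes from the
  digits outside the windows, and \<open>exp (s * d)\<close> arises because the threshold has
  \<open>Suc q\<close> copies of \<open>d\<close> while a class has only \<open>q\<close>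
  windows.\<close>

lemma card_large_fourier:
  assumes p: "p \<ge> 2" and A: "finite A" "A \<noteq> {}" "\<And>a. a \<in> A \<Longrightarrow> a \<le> p"
    and k: "k \<ge> 1" and s: "s \<ge> 0"
  shows "real (card {x \<in> {..<p ^ (k * Suc q)}.
      norm (fourier (missing_digits_measure p A) (real x)) \<ge> real p powr (- (real (k * Suc q) * d))})
    \<le> real k * exp (s * d) * real (p ^ k) *
      (real (p ^ k) * measure_pmf.expectation (pmf_of_set {..<p ^ k}) (\<lambda>v. exp (s * (d - step_value p A k v)))) ^ q"
proof -
  define X where "X = step_value p A k"
  define T where "T = (\<lambda>c x. \<Sum>i<q. X (x div p ^ (c + k * i) mod p ^ k))"
  define B where "B = {x \<in> {..<p ^ (k * Suc q)}.
      norm (fourier (missing_digits_measure p A) (real x)) \<ge> real p powr (- (real (k * Suc q) * d))}"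
  have p0: "p > 0" using p by simp
  \<comment> \<open>The exponential sum majorises the indicator of \<open>B\<close>: for
    \<open>x\<close> in \<open>B\<close>, the class sums \<open>T c x\<close> average to at most
    \<open>Suc q * d\<close>, so one of the exponents is nonnegative.\<close>
  have "1 \<le> (\<Sum>c<k. exp (s * (real (Suc q) * d - T c x)))" if "x \<in> B" for x
  proof -
    have "real p powr (- (real (k * Suc q) * d)) \<le> real p powr (- (\<Sum>c<k. T c x))"
      using that norm_fourier_le_step_values[OF p A, of x k q] unfolding B_def T_def X_def by simp
    then have "(\<Sum>c<k. T c x) \<le> real (k * Suc q) * d"
      using p by (subst (asm) powr_le_cancel_iff) auto
    then have le: "(\<Sum>c<k. T c x) \<le> (\<Sum>c<k. real (Suc q) * d)" by (simp add: algebra_simps)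
    have "\<exists>c<k. T c x \<le> real (Suc q) * d"
    proof (rule ccontr)
      assume "\<not> ?thesis"
      then have "(\<Sum>c<k. real (Suc q) * d) < (\<Sum>c<k. T c x)"
        using k by (intro sum_strict_mono) (auto simp: not_le lessThan_empty_iff)
      then show False using le by simp
    qed
    then obtain c where c: "c < k" "T c x \<le> real (Suc q) * d" by blast
    then have "1 \<le> exp (s * (real (Suc q) * d - T c x))" using s by simp
    also have "\<dots> \<le> (\<Sum>c<k. exp (s * (real (Suc q) * d - T c x)))"
      using c by (intro member_le_sum) auto
    finally show ?thesis .
  qed
  then have "real (card B) \<le> (\<Sum>x\<in>B. \<Sum>c<k. exp (s * (real (Suc q) * d - T c x)))"
    using sum_mono[of B "\<lambda>_. 1::real"] by simp
  also have "\<dots> \<le> (\<Sum>x<p ^ (k * Suc q). \<Sum>c<k. exp (s * (real (Suc q) * d - T c x)))"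
    by (intro sum_mono2) (auto simp: B_def intro!: sum_nonneg)
  also have "\<dots> = (\<Sum>c<k. \<Sum>x<p ^ (k * Suc q). exp (s * (real (Suc q) * d - T c x)))"
    by (rule sum.swap)
  also have "\<dots> = (\<Sum>c<k. exp (s * d) * (of_nat (p ^ k) * (\<Sum>v<p ^ k. exp (s * (d - X v))) ^ q))"
  proof (intro sum.cong refl)
    fix c assume "c \<in> {..<k}"
    then have "c \<le> k" by simp
    have "exp (s * (real (Suc q) * d - T c x)) = exp (s * d) * (\<Prod>i<q. exp (s * (d - X (x div p ^ (c + k * i) mod p ^ k))))" for x
    proof -
      have "s * (real (Suc q) * d - T c x) = s * d + (\<Sum>i<q. s * (d - X (x div p ^ (c + k * i) mod p ^ k)))"
        by (simp add: T_def sum_subtractf algebra_simps sum_distrib_left)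
      then show ?thesis by (simp add: exp_add exp_sum)
    qed
    then show "(\<Sum>x<p ^ (k * Suc q). exp (s * (real (Suc q) * d - T c x)))
        = exp (s * d) * (of_nat (p ^ k) * (\<Sum>v<p ^ k. exp (s * (d - X v))) ^ q)"
      using sum_prod_digits_shifted[OF p0 \<open>c \<le> k\<close>, where q = q and f = "\<lambda>v. exp (s * (d - X v))"]
      by (simp add: sum_distrib_left[symmetric])
  qed
  also have "(\<Sum>v<p ^ k. exp (s * (d - X v))) =
      real (p ^ k) * measure_pmf.expectation (pmf_of_set {..<p ^ k}) (\<lambda>v. exp (s * (d - X v)))"
    using p0 by (subst integral_pmf_of_set) (auto simp: lessThan_empty_iff)
  finally show ?thesis unfolding B_def X_def by (simp add: mult.assoc)
qed

lemma fourier_0: "prob_space M \<Longrightarrow> fourier M 0 = 1"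
  by (simp add: fourier_def prob_space.prob_space)

text \<open>Choose \<open>q\<close> with \<open>N\<close> between consecutive powers of
  \<open>p ^ k\<close>. Every frequency up to \<open>N\<close> then has at most
  \<open>k * Suc q\<close> digits, and its threshold is at least the uniform one of
  \<open>B\<close>; the moment hypothesis makes each window contribute
  \<open>(p ^ k) powr (1 - lam)\<close>.\<close>

lemma residue_bound_missing_digits:
  assumes p: "p \<ge> 2" and A: "finite A" "A \<noteq> {}" "\<And>a. a \<in> A \<Longrightarrow> a \<le> p"
    and k: "k \<ge> 1" and d: "d \<ge> 0" and s: "s \<ge> 0"
    and mgf: "measure_pmf.expectation (pmf_of_set {..<p ^ k}) (\<lambda>v. exp (s * (d - step_value p A k v)))
      \<le> real (p ^ k) powr (- lam)"
  shows "residue_bound (missing_digits_measure p A) d lam"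
proof -
  let ?\<mu> = "missing_digits_measure p A" and ?b = "real (p ^ k)"
  define K where "K = real k * exp (s * d) * ?b"
  have b2: "2 \<le> p ^ k" using p k self_le_power[of p k] by linarith
  have b: "?b > 0" using p by simp
  have bound: "real (card {\<xi> \<in> {0..int N}. norm (fourier ?\<mu> (of_int \<xi>)) \<ge> real_of_int \<bar>\<xi>\<bar> powr (- d)})
      \<le> K * max 1 (?b powr (lam - 1)) * real N powr (1 - lam)" if N: "N \<ge> 1" for N
  proof -
    obtain q where q: "(p ^ k) ^ q \<le> N" "N < (p ^ k) ^ (q + 1)"
      using ex_power_ivl1[OF b2 N] by blast
    define B where "B = {x \<in> {..<p ^ (k * Suc q)}.
        norm (fourier ?\<mu> (real x)) \<ge> real p powr (- (real (k * Suc q) * d))}"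
    have "{\<xi> \<in> {0..int N}. norm (fourier ?\<mu> (of_int \<xi>)) \<ge> real_of_int \<bar>\<xi>\<bar> powr (- d)} \<subseteq> int ` B"
    proof
      fix \<xi> assume \<xi>: "\<xi> \<in> {\<xi> \<in> {0..int N}. norm (fourier ?\<mu> (of_int \<xi>)) \<ge> real_of_int \<bar>\<xi>\<bar> powr (- d)}"
      then obtain x where x: "\<xi> = int x" "x \<le> N"
        by (auto intro: that[of "nat \<xi>"])
      then have lt: "x < p ^ (k * Suc q)" using q(2) by (simp add: power_mult power_add)
      have "real p powr (- (real (k * Suc q) * d)) = (real p powr real (k * Suc q)) powr (- d)"
        by (simp add: powr_powr)
      also have "\<dots> = real (p ^ (k * Suc q)) powr (- d)"
        using p by (subst powr_realpow) auto
      also have "\<dots> \<le> norm (fourier ?\<mu> (real x))"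
      proof (cases "x = 0")
        \<comment> \<open>Frequency 0 is counted because \<open>0 powr (- d) = 0\<close>; it belongs
          to \<open>B\<close> because the transform there is 1.\<close>
        case True
        have "1 \<le> real (p ^ (k * Suc q))" using lt by linarith
        then have "real (p ^ (k * Suc q)) powr (- d) \<le> 1 powr (- d)"
          using d by (intro powr_mono2') auto
        then show ?thesis using True fourier_0[OF prob_space_missing_digits_measure, of p A] by simp
      next
        case False
        then have "real (p ^ (k * Suc q)) powr (- d) \<le> real x powr (- d)"
          using d lt by (intro powr_mono2') (auto simp del: of_nat_power)
        also have "\<dots> \<le> norm (fourier ?\<mu> (real x))" using \<xi> x by simp
        finally show ?thesis .
      qed
      finally show "\<xi> \<in> int ` B" using lt x unfolding B_def by blast
    qed
    moreover have finB: "finite B" by (simp add: B_def)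
    ultimately have "card {\<xi> \<in> {0..int N}. norm (fourier ?\<mu> (of_int \<xi>)) \<ge> real_of_int \<bar>\<xi>\<bar> powr (- d)} \<le> card (int ` B)"
      by (intro card_mono finite_imageI)
    also have "\<dots> = card B" by (rule card_image) simp
    finally have "real (card {\<xi> \<in> {0..int N}. norm (fourier ?\<mu> (of_int \<xi>)) \<ge> real_of_int \<bar>\<xi>\<bar> powr (- d)}) \<le> real (card B)"
      by simp
    also have "\<dots> \<le> K * (?b * measure_pmf.expectation (pmf_of_set {..<p ^ k}) (\<lambda>v. exp (s * (d - step_value p A k v)))) ^ q"
      unfolding B_def K_def by (rule card_large_fourier[OF p A k s])
    also have "\<dots> \<le> K * (?b * ?b powr (- lam)) ^ q"
      using mgf b by (intro mult_left_mono power_mono mult_nonneg_nonneg Bochner_Integration.integral_nonneg)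
        (auto simp: K_def)
    also have "?b * ?b powr (- lam) = ?b powr (1 - lam)"
      using b powr_add[of ?b 1 "- lam"] by simp
    also have "(?b powr (1 - lam)) ^ q = (?b ^ q) powr (1 - lam)"
      using b by (simp add: powr_power powr_realpow[symmetric] powr_powr ac_simps)
    \<comment> \<open>The sign of \<open>1 - lam\<close> decides which end of the range of
      \<open>N\<close> is used: the lower end if the power is nondecreasing, otherwise the upper end
      at the cost of a constant.\<close>
    also have "(?b ^ q) powr (1 - lam) \<le> max 1 (?b powr (lam - 1)) * real N powr (1 - lam)"
    proof -
      have le: "?b ^ q \<le> real N" "real N / ?b \<le> ?b ^ q"
        using q b by (simp_all flip: of_nat_power of_nat_mult add: pos_divide_le_eq ac_simps)
      show ?thesis
      proof (cases "lam \<le> 1")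
        case True
        then have "(?b ^ q) powr (1 - lam) \<le> 1 * real N powr (1 - lam)"
          using le by (simp add: powr_mono2)
        also have "\<dots> \<le> max 1 (?b powr (lam - 1)) * real N powr (1 - lam)"
          by (intro mult_right_mono) auto
        finally show ?thesis .
      next
        case False
        then have "(?b ^ q) powr (1 - lam) \<le> (real N / ?b) powr (1 - lam)"
          using le N b by (intro powr_mono2') auto
        also have "\<dots> = ?b powr (lam - 1) * real N powr (1 - lam)"
          using b by (simp add: powr_divide powr_minus_divide[of _ "1 - lam", simplified])
        also have "\<dots> \<le> max 1 (?b powr (lam - 1)) * real N powr (1 - lam)"
          by (intro mult_right_mono) auto
        finally show ?thesis .
      qed
    qed
    finally show ?thesis
      by (simp add: K_def mult.assoc mult_left_mono)
  qed
  show ?thesis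
    unfolding residue_bound_def
    by (rule bigoI[where c = "K * max 1 (?b powr (lam - 1))"], rule eventually_mono[OF eventually_ge_at_top[of 1]])
      (use bound in simp)
qed

section \<open>Convergence of the step means\<close>

text \<open>Any level below \<phi>(x) is exceeded on a whole ball around \<open>x\<close>, and the
  cell containing \<open>x\<close>, of length \<open>p\<close> to the power \<open>-k\<close>,
  eventually lies in that ball.\<close>

lemma lyapunov_le_liminf_lyapunov_step:
  assumes p: "p \<ge> 2"
  shows "e2ennreal (lyapunov p A x) \<le> liminf (\<lambda>k. e2ennreal (lyapunov_step p A k x))"
  unfolding le_Liminf_iff
proof (intro allI impI)
  fix y assume y: "y < e2ennreal (lyapunov p A x)"
  then obtain c where c: "c \<ge> 0" "y = ennreal c"
    by (cases y) auto
  have "ereal c < lyapunov p A x"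
  proof (rule ccontr)
    assume "\<not> ?thesis"
    then have "e2ennreal (lyapunov p A x) \<le> e2ennreal (ereal c)" by (intro e2ennreal_mono) simp
    then show False using y c by simp
  qed
  \<comment> \<open>An infimum preserves only weak inequalities, so an intermediate level keeps the
    final one strict.\<close>
  then obtain c' where c': "c < c'" "ereal c' < lyapunov p A x"
    using ereal_dense2 by fastforce
  obtain e where e: "e > 0" "ball x e \<subseteq> {y. ereal c' < lyapunov p A y}"
    using open_lyapunov_greater[OF p, of c' A] c'(2) by (auto simp: open_contains_ball)
  have "(\<lambda>k. (1 / real p) ^ k) \<longlonglongrightarrow> 0"
    using p by (intro LIMSEQ_power_zero) auto
  then have "\<forall>\<^sub>F k in sequentially. (1 / real p) ^ k < e"
    using e(1) by (rule order_tendstoD)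
  then show "\<forall>\<^sub>F k in sequentially. y < e2ennreal (lyapunov_step p A k x)"
  proof eventually_elim
    case (elim k)
    have pk: "real p ^ k > 0" using p by simp
    have "ereal c' \<le> lyapunov_step p A k x"
      unfolding lyapunov_step_def Let_def
    proof (rule INF_greatest)
      fix z assume z: "z \<in> {of_int \<lfloor>x * real p ^ k\<rfloor> / real p ^ k ..< (of_int \<lfloor>x * real p ^ k\<rfloor> + 1) / real p ^ k}"
      have "\<bar>x * real p ^ k - z * real p ^ k\<bar> < 1"
        using z pk by (simp add: pos_divide_le_eq pos_less_divide_eq) linarith
      then have "\<bar>x - z\<bar> * real p ^ k < 1"
        using pk by (simp add: left_diff_distrib[symmetric] abs_mult)
      then have "\<bar>x - z\<bar> < (1 / real p) ^ k"
        using pk by (simp add: power_one_over pos_less_divide_eq)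
      then have "z \<in> ball x e" using elim by (simp add: dist_real_def)
      then show "ereal c' \<le> lyapunov p A z" using e(2) by auto
    qed
    then have "ennreal c' \<le> e2ennreal (lyapunov_step p A k x)"
      using e2ennreal_mono by fastforce
    moreover have "y < ennreal c'" using c c' by (simp add: ennreal_less_iff)
    ultimately show ?case by simp
  qed
qed

lemma borel_measurable_lyapunov_step [measurable]:
  "lyapunov_step p A k \<in> borel_measurable borel"
proof -
  have "(\<lambda>x. (\<lambda>j. INF y\<in>{of_int j / real p ^ k ..< (of_int j + 1) / real p ^ k}. lyapunov p A y) \<lfloor>x * real p ^ k\<rfloor>) \<in> borel_measurable borel"
    \<comment> \<open>The step function factors through the integer-valued floor, and every function
      on a countable discrete space is measurable.\<close>
    by (rule measurable_compose[where N = "count_space UNIV"]) measurable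
  then show ?thesis by (simp add: lyapunov_step_def[abs_def] Let_def)
qed

lemma nn_integral_lyapunov_step:
  assumes p: "p \<ge> 2" and A: "finite A" "A \<noteq> {}"
  shows "(\<integral>\<^sup>+x\<in>{0..1}. e2ennreal (lyapunov_step p A k x) \<partial>lborel) = ennreal (step_mean p A k)"
proof -
  let ?b = "real p ^ k"
  define I where "I = (\<lambda>j::nat. {real j / ?b..<(real j + 1) / ?b})"
  have b: "?b > 0" using p by simp
  have I_iff: "x \<in> I j \<longleftrightarrow> \<lfloor>x * ?b\<rfloor> = int j" for x j
    using b by (auto simp: I_def floor_eq_iff pos_divide_le_eq pos_less_divide_eq)
  have "(\<integral>\<^sup>+x\<in>{0..1}. e2ennreal (lyapunov_step p A k x) \<partial>lborel) =
      (\<integral>\<^sup>+x. (\<Sum>j<p ^ k. ennreal (step_value p A k j) * indicator (I j) x) \<partial>lborel)"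
  proof (rule nn_integral_cong_AE)
    show "AE x in lborel. e2ennreal (lyapunov_step p A k x) * indicator {0..1} x =
        (\<Sum>j<p ^ k. ennreal (step_value p A k j) * indicator (I j) x)"
      \<comment> \<open>The point 1 lies in the cell with index \<open>p ^ k\<close>, outside the
        sum, so it is discarded as a null set.\<close>
      using AE_lborel_singleton[of 1]
    proof eventually_elim
      case (elim x)
      show ?case
      proof (cases "x \<in> {0..1}")
        case True
        then have x: "0 \<le> x * ?b" "x * ?b < ?b" using elim b by auto
        define n where "n = nat \<lfloor>x * ?b\<rfloor>"
        have n: "\<lfloor>x * ?b\<rfloor> = int n" using x by (simp add: n_def)
        have "real n \<le> x * ?b" using n by (simp add: floor_eq_iff)
        with x have "real n < real p ^ k" by linarith
        then have "n < p ^ k" by (metis of_nat_less_iff of_nat_power)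
        have "(\<Sum>j<p ^ k. ennreal (step_value p A k j) * indicator (I j) x) =
            (\<Sum>j<p ^ k. if n = j then ennreal (step_value p A k j) else 0)"
          by (intro sum.cong) (auto simp: indicator_def I_iff n)
        also have "\<dots> = e2ennreal (ereal (step_value p A k n))" using \<open>n < p ^ k\<close> by simp
        also have "\<dots> = e2ennreal (lyapunov_step p A k x)"
          using lyapunov_step_eq[OF _ n] p ereal_step_value[OF p A] by simp
        finally show ?thesis using True by simp
      next
        case False
        have "x \<notin> I j" if "j < p ^ k" for j
        proof
          assume "x \<in> I j"
          then have "real j \<le> x * ?b" "x * ?b < real j + 1"
            using b by (auto simp: I_def pos_divide_le_eq pos_less_divide_eq)
          moreover have "real j + 1 \<le> ?b" using that by (simp flip: of_nat_power of_nat_Suc)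
          ultimately have "0 \<le> x * ?b" "x * ?b \<le> 1 * ?b" by linarith+
          then show False using False b by (auto simp: zero_le_mult_iff mult_le_cancel_right)
        qed
        then show ?thesis using False by simp
      qed
    qed
  qed
  also have "\<dots> = (\<Sum>j<p ^ k. ennreal (step_value p A k j) * emeasure lborel (I j))"
    by (subst nn_integral_sum) (auto simp: nn_integral_cmult_indicator I_def)
  also have "\<dots> = (\<Sum>j<p ^ k. ennreal (step_value p A k j / ?b))"
    using b p step_value_nonneg[of p A k]
    by (intro sum.cong refl) (simp add: I_def divide_right_mono ennreal_mult''[symmetric] flip: diff_divide_distrib)
  also have "\<dots> = ennreal (\<Sum>j<p ^ k. step_value p A k j / ?b)"
    using b p step_value_nonneg[of p A k] by (intro sum_ennreal) simp
  also have "(\<Sum>j<p ^ k. step_value p A k j / ?b) = step_mean p A k"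
    unfolding step_mean_def using p
    by (subst integral_pmf_of_set) (auto simp: lessThan_empty_iff sum_divide_distrib)
  finally show ?thesis .
qed

text \<open>By Fatou, \<open>c\<close> is strictly below the lower limit of the step means, so all
  late means exceed it.\<close>

lemma ex_step_mean_greater:
  assumes p: "p \<ge> 2" and A: "finite A" "A \<noteq> {}" and c: "c \<ge> 0"
    and int: "(\<integral>\<^sup>+x\<in>{0..1}. e2ennreal (lyapunov p A x) \<partial>lborel) > ennreal c"
  shows "\<exists>k\<ge>K. step_mean p A k > c"
proof -
  note int
  also have "(\<integral>\<^sup>+x\<in>{0..1}. e2ennreal (lyapunov p A x) \<partial>lborel)
      \<le> (\<integral>\<^sup>+x. liminf (\<lambda>k. e2ennreal (lyapunov_step p A k x) * indicator {0..1} x) \<partial>lborel)"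
    using lyapunov_le_liminf_lyapunov_step[OF p]
    by (intro nn_integral_mono) (auto simp: indicator_def)
  also have "\<dots> \<le> liminf (\<lambda>k. \<integral>\<^sup>+x\<in>{0..1}. e2ennreal (lyapunov_step p A k x) \<partial>lborel)"
    by (rule nn_integral_liminf) measurable
  also have "\<dots> = liminf (\<lambda>k. ennreal (step_mean p A k))"
    by (simp add: nn_integral_lyapunov_step[OF p A])
  finally have "\<forall>\<^sub>F k in sequentially. ennreal c < ennreal (step_mean p A k)"
    by (rule less_LiminfD)
  then obtain k where "k \<ge> K" "ennreal c < ennreal (step_mean p A k)"
    unfolding eventually_sequentially by (meson nat_le_linear)
  then show ?thesis using c by (auto simp: ennreal_less_iff)
qed

section \<open>Bernstein's exponent and the passage to the limit 1/2\<close>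

lemma step_value_le_step_max: "j < p ^ k \<Longrightarrow> step_value p A k j \<le> step_max p A k"
  unfolding step_max_def by (intro Max_ge) auto

lemma step_mean_le_step_max:
  assumes "p > 0"
  shows "step_mean p A k \<le> step_max p A k"
proof -
  have "set_pmf (pmf_of_set {..<p ^ k}) = {..<p ^ k}"
    using assms by (intro set_pmf_of_set) (auto simp: lessThan_empty_iff)
  then show ?thesis
    unfolding step_mean_def
    by (intro measure_pmf.integral_le_const integrable_measure_pmf_finite AE_pmfI)
      (auto intro: step_value_le_step_max)
qed

text \<open>The exponent is the \<open>lam\<close> for which \<open>(p ^ k) powr (- lam)\<close>
  equals the Chernoff bound \<open>exp (- (t\<^sup>2 / 2 / D))\<close>; dividing by
  \<open>k * ln p\<close> converts the base.\<close>

lemma residue_bound_bernstein: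
  assumes p: "p \<ge> 2" and A: "finite A" "A \<noteq> {}" "\<And>a. a \<in> A \<Longrightarrow> a \<le> p"
    and k: "k \<ge> 1" and d: "0 \<le> d" "d < step_mean p A k"
  defines "t \<equiv> step_mean p A k - d"
  shows "residue_bound (missing_digits_measure p A) d
    (t\<^sup>2 / 2 / (step_var p A k + step_max p A k * t / 3) / (real k * ln (real p)))"
proof -
  let ?M = "pmf_of_set {..<p ^ k}" and ?X = "step_value p A k"
  define D where "D = step_var p A k + step_max p A k * t / 3"
  have set: "set_pmf ?M = {..<p ^ k}"
    using p by (intro set_pmf_of_set) (auto simp: lessThan_empty_iff)
  have "step_mean p A k \<le> step_max p A k"
    using p by (intro step_mean_le_step_max) simp
  \<comment> \<open>Since \<open>X\<close> is nonnegative, its deviation below the mean is at most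
    the mean, hence at most the maximum.\<close>
  then have C: "step_max p A k > 0" and
    lower: "measure_pmf.expectation ?M ?X - ?X v \<le> step_max p A k" for v
    using d step_value_nonneg[of p A k v] p unfolding step_mean_def by auto
  have t: "t > 0" using d by (simp add: t_def)
  have "step_var p A k \<ge> 0" unfolding step_var_def by simp
  then have D: "D > 0" using C t unfolding D_def by (intro add_nonneg_pos) auto
  have "real (p ^ k) powr (- (t\<^sup>2 / 2 / D / (real k * ln (real p)))) = exp (- (t\<^sup>2 / 2 / D))"
    using p k by (simp add: powr_def ln_realpow)
  moreover have "measure_pmf.expectation ?M (\<lambda>v. exp (t / D * (d - ?X v))) \<le> exp (- (t\<^sup>2 / 2 / D))"
    using bernstein_chernoff[OF _ lower C, of d t D] set d
    by (simp add: D_def t_def step_mean_def step_var_def)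
  ultimately show ?thesis
    unfolding D_def[symmetric]
    using t D by (intro residue_bound_missing_digits[OF p A k d(1), of "t / D"]) simp_all
qed

theorem theorem7p5:
  fixes p :: nat and A :: "nat set" and \<mu> :: "real measure"
  assumes "p \<ge> 3"
    and "A \<subseteq> {0..p - 1}" and "0 \<in> A" and "1 < card A" and "card A < p"
    and "\<mu> = missing_digits_measure p A"
    and "(\<integral>\<^sup>+x\<in>{0..1}. e2ennreal (lyapunov p A x) \<partial>lborel) > 1/2"
  shows "spectral \<mu> \<and>
    (\<exists>k\<ge>1. step_mean p A k > 1/2 \<and> (\<forall>j. 1 \<le> j \<and> j < k \<longrightarrow> \<not> step_mean p A j > 1/2) \<and>
      residue_dim \<mu> \<ge> ereal (1 / ln (real p) *
        (((step_mean p A k - 1/2)^2 / 2) /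
          (real k * step_var p A k + 1/3 * real k * step_max p A k * (step_mean p A k - 1/2)))))"
proof -
  have p: "p \<ge> 2" using assms(1) by simp
  have A: "finite A" "A \<noteq> {}" "\<And>a. a \<in> A \<Longrightarrow> a \<le> p"
    using assms(2,3) finite_subset by fastforce+
  have "ennreal (1/2) = 1/2"
    by (simp add: divide_ennreal_def)
  then have "\<exists>k\<ge>1. step_mean p A k > 1/2"
    using assms(7) by (intro ex_step_mean_greater[OF p A(1,2)]) simp_all
  then obtain k where k: "k \<ge> 1" "step_mean p A k > 1/2"
    and min: "\<And>j. 1 \<le> j \<and> j < k \<Longrightarrow> \<not> step_mean p A j > 1/2"
    using exists_least_iff[of "\<lambda>k. 1 \<le> k \<and> step_mean p A k > 1/2"] by blast
  define m where "m = step_mean p A k"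
  \<comment> \<open>\<open>L (m - d)\<close> is the exponent available at
    \<open>\<Delta> = d\<close>.\<close>
  define L where "L = (\<lambda>t. t\<^sup>2 / 2 / (step_var p A k + step_max p A k * t / 3) / (real k * ln (real p)))"
  have bound: "residue_bound \<mu> d (L (m - d))" if "0 \<le> d" "d < m" for d
    using residue_bound_bernstein[OF p A k(1), of d] that unfolding L_def m_def assms(6) by simp
  have lnp: "ln (real p) > 0" using p by simp
  have V: "step_var p A k \<ge> 0" unfolding step_var_def by simp
  have C: "step_max p A k > 0"
    using step_mean_le_step_max[of p A k] p k(2) by linarith
  have L_pos: "L t > 0" if "t > 0" for t
    unfolding L_def using that V C k(1) lnp by (intro divide_pos_pos add_nonneg_pos mult_pos_pos) auto
  have "spectral \<mu>"
    unfolding spectral_def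
    \<comment> \<open>The midpoint of 1/2 and \<open>m\<close> serves as
      \<open>\<Delta>\<close>.\<close>
    using bound[of "(1/2 + m) / 2"] L_pos[of "m - (1/2 + m) / 2"] k(2)
    by (intro exI[of _ "(1/2 + m) / 2"] exI[of _ "L (m - (1/2 + m) / 2)"] conjI) (auto simp: m_def field_simps)
  moreover have "ereal (L (m - 1/2)) \<le> residue_dim \<mu>"
  \<comment> \<open>The residue dimension admits only \<open>\<Delta> > 1/2\<close>, so the value at
    1/2 is reached as a right-hand limit by continuity of \<open>L\<close>.\<close>
  proof (rule tendsto_upperbound)
    have "isCont (\<lambda>d. L (m - d)) (1/2)"
      unfolding L_def using k V C lnp
      by (intro continuous_intros) (auto simp: m_def add_nonneg_eq_0_iff)
    then have "((\<lambda>d. L (m - d)) \<longlongrightarrow> L (m - 1/2)) (at (1/2))"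
      by (simp add: isCont_def)
    then show "((\<lambda>d. ereal (L (m - d))) \<longlongrightarrow> ereal (L (m - 1/2))) (at_right (1/2))"
      by (intro tendsto_ereal) (rule tendsto_within_subset, auto)
    have "ereal (L (m - d)) \<le> residue_dim \<mu>" if "1/2 < d" "d < m" for d
      unfolding residue_dim_def using that bound[of d] L_pos[of "m - d"]
      by (intro Sup_upper imageI) auto
    then show "\<forall>\<^sub>F d in at_right (1/2). ereal (L (m - d)) \<le> residue_dim \<mu>"
      using k(2) unfolding eventually_at_right_field m_def by blast
  qed simp
  moreover have "L (m - 1/2) = 1 / ln (real p) *
        (((step_mean p A k - 1/2)^2 / 2) /
          (real k * step_var p A k + 1/3 * real k * step_max p A k * (step_mean p A k - 1/2)))"
  proof -
    have "real k * step_var p A k + 1/3 * real k * step_max p A k * (step_mean p A k - 1/2) =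
       real k * (step_var p A k + step_max p A k * (m - 1/2) / 3)"
      by (simp add: m_def algebra_simps)
    then show ?thesis by (simp only: L_def m_def) simp
  qed
  ultimately show ?thesis using k min by auto
qed

end
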